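(* The VC-dimension of any Latin square graph of order at least $225$ (that is, with at least $225$ vertices) is $4$.
   Context: All graphs are finite and simple. A Latin square of order $m$ is an $m\times m$ matrix $L$ with entries in $[m]=\{1,\dots,m\}$ such that each row and each column contains each entry exactly once. Its Latin square graph $G(L)$ has vertex set $\{(i,j,L_{i,j}):i,j\in[m]\}$, where two distinct vertices $(i,j,L_{i,j})$ and $(k,\ell,L_{k,\ell})$ are adjacent if and only if $i=k$, $j=\ell$, or $L_{i,j}=L_{k,\ell}$. The order of the Latin square graph is its number of vertices $m^2$ (the square of the order of the Latin square). The VC-dimension of a graph $G$ is the maximum size of a set $S\subseteq V(G)$ that is shattered, meaning that for every $A\subseteq S$ there is a vertex $u\in V(G)$ (possibly $u\in S$) with $N(u)\cap S=A$, where $N(u)$ is the open neighborhood of $u$. *)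

theory Defs
  imports "Graph_Theory.Pair_Digraph"
begin

text \<open>
  A finite simple graph is a symmetric loop-free digraph without parallel arcs
  (locale \<^locale>\<open>pair_graph\<close>): each undirected edge is represented by its two arcs.
\<close>

definition open_neighborhood :: "'a pair_pre_digraph \<Rightarrow> 'a \<Rightarrow> 'a set" where
  "open_neighborhood G u = {v \<in> pverts G. (u, v) \<in> parcs G}"

definition shattered :: "'a pair_pre_digraph \<Rightarrow> 'a set \<Rightarrow> bool" where
  "shattered G S \<longleftrightarrow> S \<subseteq> pverts G \<and>
     (\<forall>A. A \<subseteq> S \<longrightarrow> (\<exists>u \<in> pverts G. open_neighborhood G u \<inter> S = A))"

definition vc_dim :: "'a pair_pre_digraph \<Rightarrow> nat" where
  "vc_dim G = Max {card S | S. shattered G S}"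

text \<open>
  The maximum ranges over a nonempty finite set whenever the graph is finite and
  has a vertex.
\<close>

lemma finite_shattered_cards:
  assumes "finite (pverts G)"
  shows "finite {card S | S. shattered G S}"
proof -
  have "{card S | S. shattered G S} \<subseteq> card ` Pow (pverts G)"
    by (auto simp: shattered_def)
  then show ?thesis
    using assms by (meson finite_Pow_iff finite_imageI finite_subset)
qed

lemma shattered_empty: "pverts G \<noteq> {} \<Longrightarrow> shattered G {}"
  by (auto simp: shattered_def)

text \<open>
  An \<open>m \<times> m\<close> matrix over \<open>[m]\<close> is a function on pairs of indices; only its values on
  \<open>{1..m} \<times> {1..m}\<close> are relevant.
\<close>

definition latin_square :: "nat \<Rightarrow> (nat \<Rightarrow> nat \<Rightarrow> nat) \<Rightarrow> bool" where
  "latin_square m L \<longleftrightarrow>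
     (\<forall>i \<in> {1..m}. \<forall>j \<in> {1..m}. L i j \<in> {1..m}) \<and>
     (\<forall>i \<in> {1..m}. \<forall>k \<in> {1..m}. \<exists>!j. j \<in> {1..m} \<and> L i j = k) \<and>
     (\<forall>j \<in> {1..m}. \<forall>k \<in> {1..m}. \<exists>!i. i \<in> {1..m} \<and> L i j = k)"

definition latin_vertices :: "nat \<Rightarrow> (nat \<Rightarrow> nat \<Rightarrow> nat) \<Rightarrow> (nat \<times> nat \<times> nat) set" where
  "latin_vertices m L = {(i, j, L i j) | i j. i \<in> {1..m} \<and> j \<in> {1..m}}"

definition latin_adj :: "nat \<times> nat \<times> nat \<Rightarrow> nat \<times> nat \<times> nat \<Rightarrow> bool" where
  "latin_adj = (\<lambda>(i, j, a) (k, l, b). (i, j, a) \<noteq> (k, l, b) \<and> (i = k \<or> j = l \<or> a = b))"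

definition latin_square_graph ::
    "nat \<Rightarrow> (nat \<Rightarrow> nat \<Rightarrow> nat) \<Rightarrow> (nat \<times> nat \<times> nat) pair_pre_digraph" where
  "latin_square_graph m L =
     \<lparr> pverts = latin_vertices m L,
       parcs = {(u, v). u \<in> latin_vertices m L \<and> v \<in> latin_vertices m L \<and> latin_adj u v} \<rparr>"

lemma latin_vertices_image:
  "latin_vertices m L = (\<lambda>(i, j). (i, j, L i j)) ` ({1..m} \<times> {1..m})"
  by (auto simp: latin_vertices_def)

lemma finite_latin_vertices: "finite (latin_vertices m L)"
  by (simp add: latin_vertices_image)

lemma card_latin_vertices: "card (pverts (latin_square_graph m L)) = m\<^sup>2"
  by (simp add: latin_square_graph_def latin_vertices_image card_image inj_on_def
      power2_eq_square split_beta prod_eq_iff)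

lemma pair_graph_latin_square_graph: "pair_graph (latin_square_graph m L)"
proof
  show "finite (parcs (latin_square_graph m L))"
    by (rule finite_subset[of _ "latin_vertices m L \<times> latin_vertices m L"])
       (auto simp: latin_square_graph_def finite_latin_vertices)
  show "symmetric (with_proj (latin_square_graph m L))"
    by (auto simp: symmetric_def sym_def latin_square_graph_def latin_adj_def)
qed (auto simp: latin_square_graph_def latin_adj_def finite_latin_vertices)

end

theory Submission
  imports Defs
begin

text \<open>
  Regard the vertices as the points of a 3-net whose lines are the rows, columns and symbols.

  Upper bound: let \<open>S\<close> be a shattered set of size 5. The vertex adjacent to all of \<open>S\<close> has only
  three lines, so two points \<open>a, b\<close> of \<open>S\<close> share a line \<open>l\<close>. Off \<open>l\<close> there are only two common
  neighbours of \<open>a\<close> and \<open>b\<close>. If a third point \<open>c\<close> of \<open>S\<close> lies on \<open>l\<close>, then the four sets containing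
  \<open>a, b\<close> but not \<open>c\<close> have only three candidate vertices. Otherwise \<open>c\<close> has just two neighbours on
  \<open>l\<close>, so the four sets containing \<open>a, b, c\<close> use up both of these and both exceptional
  vertices. Hence both exceptional vertices are adjacent to every \<open>c\<close>, and the two of them cut out
  the same subset \<open>S\<close>, although they were chosen for different subsets.

  Lower bound: take two points in a row and two points in a column, avoiding the intersection of
  the two lines and with four distinct symbols. Each subset of size 2 with a point on both lines
  is cut out by the intersection of another row and column, provided that its symbol is generic;
  choosing the two column points greedily achieves this, since at most ten rows are forbidden.
\<close>

section \<open>Upper bound: pigeonhole counting and three-nets\<close>

lemma card_sets_between:
  assumes "finite S" "B \<subseteq> S"
  shows "card {A. B \<subseteq> A \<and> A \<subseteq> S} = 2 ^ card (S - B)"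
proof -
  have "{A. B \<subseteq> A \<and> A \<subseteq> S} = (\<lambda>T. B \<union> T) ` Pow (S - B)"
  proof (intro equalityI subsetI)
    fix A assume "A \<in> {A. B \<subseteq> A \<and> A \<subseteq> S}"
    then have "A = B \<union> (A - B)" "A - B \<in> Pow (S - B)" by auto
    then show "A \<in> (\<lambda>T. B \<union> T) ` Pow (S - B)" by blast
  qed (use assms in auto)
  moreover have "inj_on (\<lambda>T. B \<union> T) (Pow (S - B))"
    by (rule inj_onI) blast
  ultimately show ?thesis
    using assms by (simp add: card_image card_Pow)
qed

lemma card_le_one_if_unique:
  assumes "\<And>x y. x \<in> X \<Longrightarrow> y \<in> X \<Longrightarrow> x = y"
  shows "finite X \<and> card X \<le> 1"
proof (cases "X = {}")
  case False
  then obtain x where "X = {x}" using assms by blast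
  then show ?thesis by simp
qed simp

text \<open>The pigeonhole step of the upper bound. The sets \<open>X\<close>, \<open>Y\<close>,
  \<open>Z\<close> will be single vertices, sets fixed by two of their lines, or traces of a line on
  a shattered set.\<close>

lemma not_covered:
  assumes "finite X \<and> card X \<le> 1" "finite Y \<and> card Y \<le> 1" "finite Z \<and> card Z \<le> 1"
    "card W > 3"
  shows "\<not> W \<subseteq> X \<union> Y \<union> Z"
proof
  assume "W \<subseteq> X \<union> Y \<union> Z"
  then have "card W \<le> card (X \<union> Y \<union> Z)"
    using assms by (intro card_mono) auto
  also have "\<dots> \<le> card X + card Y + card Z"
    by (meson add_le_mono1 card_Un_le le_trans)
  finally show False using assms by linarith
qed

text \<open>\<open>f\<close>, \<open>g\<close> and \<open>h\<close> name the lines through a point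
  in the three parallel classes. The axioms are symmetric in them, so a fact about \<open>f\<close>
  transfers to \<open>g\<close> and \<open>h\<close> by interpretation with the roles
  permuted.\<close>

locale three_net =
  fixes V :: "'a set" and f g h :: "'a \<Rightarrow> 'b" and adj :: "'a \<Rightarrow> 'a \<Rightarrow> bool"
  assumes fg: "u \<in> V \<Longrightarrow> v \<in> V \<Longrightarrow> f u = f v \<Longrightarrow> g u = g v \<Longrightarrow> u = v"
    and fh: "u \<in> V \<Longrightarrow> v \<in> V \<Longrightarrow> f u = f v \<Longrightarrow> h u = h v \<Longrightarrow> u = v"
    and gh: "u \<in> V \<Longrightarrow> v \<in> V \<Longrightarrow> g u = g v \<Longrightarrow> h u = h v \<Longrightarrow> u = v"
    and adj_iff: "u \<in> V \<Longrightarrow> v \<in> V \<Longrightarrow>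
      adj u v \<longleftrightarrow> u \<noteq> v \<and> (f u = f v \<or> g u = g v \<or> h u = h v)"
begin

text \<open>Off the common line, \<open>u\<close> meets \<open>a\<close> and \<open>b\<close>
  through \<open>g\<close> or \<open>h\<close>. Using the same class for both would make
  \<open>a\<close> and \<open>b\<close> share two lines and coincide, so only the two mixed cases
  remain.\<close>

lemma common_neighbour:
  assumes "a \<in> V" "b \<in> V" "u \<in> V" "a \<noteq> b" "f a = f b" "adj u a" "adj u b"
  shows "f u = f a \<or> g u = g a \<and> h u = h b \<or> g u = g b \<and> h u = h a"
  using assms adj_iff[of u a] adj_iff[of u b] fg[of a b] fh[of a b] by metis

lemma shattered_inj_on:
  assumes S: "S \<subseteq> V" "card S = 5"
    and shat: "\<And>A. A \<subseteq> S \<Longrightarrow> \<exists>u\<in>V. {v \<in> S. adj u v} = A"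
  shows "inj_on f S"
proof (rule inj_onI, rule ccontr)
  fix a b assume ab: "a \<in> S" "b \<in> S" "f a = f b" "a \<noteq> b"
  \<comment> \<open>Distinct subsets get distinct vertices because \<open>A\<close> can be recovered
    from \<open>U A\<close>; hence \<open>U\<close> is injective.\<close>
  obtain U where U: "\<And>A. A \<subseteq> S \<Longrightarrow> U A \<in> V" "\<And>A. A \<subseteq> S \<Longrightarrow> {v \<in> S. adj (U A) v} = A"
    using shat by metis
  have adjU: "adj (U A) v" if "A \<subseteq> S" "v \<in> A" for A v
    using U(2)[OF that(1)] that by blast
  have inj: "inj_on U I" if "I \<subseteq> Pow S" for I
    by (rule inj_onI) (metis U(2) PowD subsetD that)
  have fin: "finite S" using S(2) by (simp add: card_ge_0_finite)
  let ?X = "{u \<in> V. g u = g a \<and> h u = h b}"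
  let ?Y = "{u \<in> V. g u = g b \<and> h u = h a}"
  have X1: "finite ?X \<and> card ?X \<le> 1" and Y1: "finite ?Y \<and> card ?Y \<le> 1"
    by (rule card_le_one_if_unique; use gh in auto)+
  have off_line: "f c \<noteq> f a" if c: "c \<in> S - {a, b}" for c
  proof
    assume fc: "f c = f a"
    let ?I = "{A. {a, b} \<subseteq> A \<and> A \<subseteq> S - {c}}"
    have "S - {c} - {a, b} = S - {a, b, c}" "card {a, b, c} = 3" using ab c by auto
    then have "card (S - {c} - {a, b}) = 2"
      using S(2) fin ab c by (simp add: card_Diff_subset)
    then have "card ?I = 4"
      using card_sets_between[of "S - {c}" "{a, b}"] fin ab c by auto
    moreover have "card (U ` ?I) = card ?I"
      by (rule card_image, rule inj) auto
    moreover have "U ` ?I \<subseteq> {c} \<union> ?X \<union> ?Y"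
    proof (rule image_subsetI)
      fix A assume A: "A \<in> ?I"
      then have AS: "A \<subseteq> S" by auto
      \<comment> \<open>Every vertex of the line other than \<open>c\<close> is adjacent to
        \<open>c\<close>; \<open>c\<close> itself survives because neighbourhoods are open.\<close>
      have "\<not> adj (U A) c" using U(2)[OF AS] A c by blast
      then have "U A = c \<or> f (U A) \<noteq> f a"
        using adj_iff[of "U A" c] U(1)[OF AS] S(1) c fc by auto
      moreover have "f (U A) = f a \<or> g (U A) = g a \<and> h (U A) = h b \<or> g (U A) = g b \<and> h (U A) = h a"
        using A AS S(1) ab by (intro common_neighbour U(1) adjU) auto
      ultimately show "U A \<in> {c} \<union> ?X \<union> ?Y"
        using U(1)[OF AS] by auto
    qed
    ultimately show False
      using not_covered[of "{c}" ?X ?Y "U ` ?I"] X1 Y1 by simp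
  qed
  have exceptional: "(\<exists>A\<subseteq>S. c \<in> A \<and> U A \<in> ?X) \<and> (\<exists>A\<subseteq>S. c \<in> A \<and> U A \<in> ?Y)"
    if c: "c \<in> S - {a, b}" for c
  proof -
    let ?I = "{A. {a, b, c} \<subseteq> A \<and> A \<subseteq> S}"
    let ?P = "{u \<in> V. f u = f a \<and> g u = g c}"
    let ?Q = "{u \<in> V. f u = f a \<and> h u = h c}"
    have P1: "finite ?P \<and> card ?P \<le> 1" and Q1: "finite ?Q \<and> card ?Q \<le> 1"
      by (rule card_le_one_if_unique; use fg fh in auto)+
    have "card {a, b, c} = 3" using ab c by auto
    then have "card (S - {a, b, c}) = 2"
      using S(2) fin ab c by (simp add: card_Diff_subset)
    then have "card ?I = 4"
      using card_sets_between[of S "{a, b, c}"] fin ab c by auto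
    moreover have "card (U ` ?I) = card ?I"
      by (rule card_image, rule inj) auto
    ultimately have card4: "card (U ` ?I) = 4" by simp
    have sub: "U ` ?I \<subseteq> ?P \<union> ?Q \<union> ?X \<union> ?Y"
    proof (rule image_subsetI)
      fix A assume A: "A \<in> ?I"
      then have AS: "A \<subseteq> S" by auto
      have "adj (U A) c" using A AS by (intro adjU) auto
      then have "f (U A) = f a \<longrightarrow> g (U A) = g c \<or> h (U A) = h c"
        using adj_iff[of "U A" c] U(1)[OF AS] S(1) c off_line[OF c] by auto
      moreover have "f (U A) = f a \<or> g (U A) = g a \<and> h (U A) = h b \<or> g (U A) = g b \<and> h (U A) = h a"
        using A AS S(1) ab by (intro common_neighbour U(1) adjU) auto
      ultimately show "U A \<in> ?P \<union> ?Q \<union> ?X \<union> ?Y"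
        using U(1)[OF AS] by auto
    qed
    \<comment> \<open>Four vertices lie in four sets of at most one element each, so none of the
      sets can be omitted. Here \<open>P\<close> stands for \<open>?P \<union> ?Q\<close>.\<close>
    have escape: "\<not> F ` I \<subseteq> P \<union> Y \<Longrightarrow> \<exists>A\<in>I. F A \<in> X" "\<not> F ` I \<subseteq> P \<union> X \<Longrightarrow> \<exists>A\<in>I. F A \<in> Y"
      if "F ` I \<subseteq> P \<union> X \<union> Y" for F :: "'a set \<Rightarrow> 'a" and I P X Y
      using that by blast+
    have "\<not> U ` ?I \<subseteq> ?P \<union> ?Q \<union> ?Y"
      using card4 by (intro not_covered P1 Q1 Y1) linarith
    then have X: "\<exists>A\<in>?I. U A \<in> ?X"
      by (rule escape(1)[OF sub])
    have "\<not> U ` ?I \<subseteq> ?P \<union> ?Q \<union> ?X"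
      using card4 by (intro not_covered P1 Q1 X1) linarith
    then have Y: "\<exists>A\<in>?I. U A \<in> ?Y"
      by (rule escape(2)[OF sub])
    from X obtain A where "A \<in> ?I" "U A \<in> ?X" ..
    moreover from Y obtain B where "B \<in> ?I" "U B \<in> ?Y" ..
    ultimately show ?thesis
      by (intro conjI exI[of _ A] exI[of _ B]) simp_all
  qed
  have "card (S - {a, b}) = 3"
    using S(2) fin ab by (simp add: card_Diff_subset)
  then have "S - {a, b} \<noteq> {}" by (metis card.empty zero_neq_numeral)
  then obtain c where c: "c \<in> S - {a, b}" by blast
  obtain A B where A: "A \<subseteq> S" "U A \<in> ?X" and B: "B \<subseteq> S" "U B \<in> ?Y"
    using exceptional[OF c] by blast
  \<comment> \<open>The exceptional vertices reach \<open>a\<close> and \<open>b\<close> by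
    definition, and equal neither since \<open>g\<close> and \<open>h\<close> separate
    \<open>a\<close> from \<open>b\<close>. For any other \<open>d\<close>, uniqueness in
    \<open>?X\<close> and \<open>?Y\<close> identifies the witnesses for \<open>d\<close> with those
    for \<open>c\<close>.\<close>
  have all_adj: "adj (U A) d \<and> adj (U B) d" if d: "d \<in> S" for d
  proof (cases "d \<in> {a, b}")
    case True
    have aV: "a \<in> V" "b \<in> V" using ab S by auto
    have "g a \<noteq> g b" "h a \<noteq> h b" using fg[of a b] fh[of a b] aV ab by auto
    then show ?thesis
      using adj_iff[OF U(1)[OF A(1)], of d] adj_iff[OF U(1)[OF B(1)], of d] A B aV True by auto
  next
    case False
    then have d': "d \<in> S - {a, b}" using d by simp
    obtain A' B' where "A' \<subseteq> S" "d \<in> A'" "U A' \<in> ?X" "B' \<subseteq> S" "d \<in> B'" "U B' \<in> ?Y"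
      using exceptional[OF d'] by blast
    moreover from this have "U A' = U A" "U B' = U B"
      using A B gh by auto
    ultimately show ?thesis using adjU by metis
  qed
  then have "A = S" "B = S"
    using U(2)[OF A(1)] U(2)[OF B(1)] by blast+
  \<comment> \<open>The single vertex \<open>U S\<close> now lies in both \<open>?X\<close> and
    \<open>?Y\<close>.\<close>
  then have "g a = g b" using A B by auto
  then show False
    using fg[of a b] ab S by blast
qed

text \<open>Each line carries at most one point of \<open>S\<close>, so the vertex adjacent to all
  of \<open>S\<close> would reach five points along only three lines.\<close>

lemma not_shattered_5:
  assumes S: "S \<subseteq> V" "card S = 5"
    and shat: "\<And>A. A \<subseteq> S \<Longrightarrow> \<exists>u\<in>V. {v \<in> S. adj u v} = A"
  shows False
proof -
  interpret gfh: three_net V g f h adj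
    by unfold_locales (use fg fh gh adj_iff in metis)+
  interpret hfg: three_net V h f g adj
    by unfold_locales (use fg fh gh adj_iff in metis)+
  have inj: "inj_on f S" "inj_on g S" "inj_on h S"
    using shattered_inj_on gfh.shattered_inj_on hfg.shattered_inj_on S shat by blast+
  obtain u where u: "u \<in> V" "{v \<in> S. adj u v} = S" using shat by blast
  have cover: "S \<subseteq> {v \<in> S. f v = f u} \<union> {v \<in> S. g v = g u} \<union> {v \<in> S. h v = h u}"
    using u S adj_iff by fastforce
  have line: "finite {v \<in> S. k v = k u} \<and> card {v \<in> S. k v = k u} \<le> 1"
    if "inj_on k S" for k :: "'a \<Rightarrow> 'b"
    by (rule card_le_one_if_unique) (metis (mono_tags, lifting) inj_onD mem_Collect_eq that)
  show False
    using not_covered[OF line[OF inj(1)] line[OF inj(2)] line[OF inj(3)], of S] cover S by simp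
qed

end

section \<open>Latin square graphs as three-nets\<close>

lemma shattered_iff:
  "shattered (latin_square_graph m L) S \<longleftrightarrow> S \<subseteq> latin_vertices m L \<and>
     (\<forall>A. A \<subseteq> S \<longrightarrow> (\<exists>u\<in>latin_vertices m L. {v \<in> S. latin_adj u v} = A))"
proof -
  have "open_neighborhood (latin_square_graph m L) u \<inter> S = {v \<in> S. latin_adj u v}"
    if "S \<subseteq> latin_vertices m L" "u \<in> latin_vertices m L" for u
    using that by (auto simp: open_neighborhood_def latin_square_graph_def)
  then show ?thesis
    by (auto simp: shattered_def latin_square_graph_def cong: conj_cong)
qed

lemma shattered_subset:
  assumes "shattered G S" "T \<subseteq> S"
  shows "shattered G T"
  unfolding shattered_def
proof (intro conjI allI impI)
  fix A assume "A \<subseteq> T"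
  then obtain u where "u \<in> pverts G" "open_neighborhood G u \<inter> S = A"
    using assms by (meson order_trans shattered_def)
  then show "\<exists>u\<in>pverts G. open_neighborhood G u \<inter> T = A"
    using \<open>A \<subseteq> T\<close> assms(2) by blast
qed (use assms in \<open>auto simp: shattered_def\<close>)

locale latin =
  fixes m :: nat and L :: "nat \<Rightarrow> nat \<Rightarrow> nat"
  assumes latin: "latin_square m L"
begin

lemma entry: "i \<in> {1..m} \<Longrightarrow> j \<in> {1..m} \<Longrightarrow> L i j \<in> {1..m}"
  using latin by (auto simp: latin_square_def)

lemma row_inj: "i \<in> {1..m} \<Longrightarrow> j \<in> {1..m} \<Longrightarrow> j' \<in> {1..m} \<Longrightarrow> L i j = L i j' \<Longrightarrow> j = j'"
  using latin entry unfolding latin_square_def by metis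

lemma col_inj: "j \<in> {1..m} \<Longrightarrow> i \<in> {1..m} \<Longrightarrow> i' \<in> {1..m} \<Longrightarrow> L i j = L i' j \<Longrightarrow> i = i'"
  using latin entry unfolding latin_square_def by metis

lemma row_ex: "i \<in> {1..m} \<Longrightarrow> k \<in> {1..m} \<Longrightarrow> \<exists>j\<in>{1..m}. L i j = k"
  using latin unfolding latin_square_def by metis

lemma col_ex: "j \<in> {1..m} \<Longrightarrow> k \<in> {1..m} \<Longrightarrow> \<exists>i\<in>{1..m}. L i j = k"
  using latin unfolding latin_square_def by metis

sublocale net: three_net "latin_vertices m L" fst "fst \<circ> snd" "snd \<circ> snd" latin_adj
proof unfold_locales
  fix u v assume "u \<in> latin_vertices m L" "v \<in> latin_vertices m L"
  then obtain i j i' j' where u: "u = (i, j, L i j)" "i \<in> {1..m}" "j \<in> {1..m}"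
    and v: "v = (i', j', L i' j')" "i' \<in> {1..m}" "j' \<in> {1..m}"
    unfolding latin_vertices_def by blast
  show "u = v" if "fst u = fst v" "(fst \<circ> snd) u = (fst \<circ> snd) v"
    using that u v by simp
  show "u = v" if "fst u = fst v" "(snd \<circ> snd) u = (snd \<circ> snd) v"
    using that u v row_inj[of i j j'] by (simp del: atLeastAtMost_iff)
  show "u = v" if "(fst \<circ> snd) u = (fst \<circ> snd) v" "(snd \<circ> snd) u = (snd \<circ> snd) v"
    using that u v col_inj[of j i i'] by (simp del: atLeastAtMost_iff)
  show "latin_adj u v \<longleftrightarrow> u \<noteq> v \<and> (fst u = fst v \<or> (fst \<circ> snd) u = (fst \<circ> snd) v \<or>
      (snd \<circ> snd) u = (snd \<circ> snd) v)"
    using u v by (simp add: latin_adj_def)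
qed

lemma card_shattered_le:
  assumes "shattered (latin_square_graph m L) S"
  shows "card S \<le> 4"
proof (rule ccontr)
  assume "\<not> card S \<le> 4"
  then obtain T where T: "T \<subseteq> S" "card T = 5"
    using obtain_subset_with_card_n[of 5 S] by auto
  have "shattered (latin_square_graph m L) T"
    using shattered_subset[OF assms T(1)] .
  then show False
    using net.not_shattered_5[of T] T(2) by (auto simp: shattered_iff)
qed

section \<open>Lower bound: a shattered set of size 4\<close>

lemma ex_row_avoiding:
  assumes "\<forall>(j, k)\<in>set ps. j \<in> {1..m}" "length ps + length rs < m"
  shows "\<exists>i\<in>{1..m}. i \<notin> set rs \<and> (\<forall>(j, k)\<in>set ps. L i j \<noteq> k)"
proof -
  \<comment> \<open>Each pair forbids at most one row, as a symbol occurs at most once in a column.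
    If \<open>k\<close> is not a symbol, \<open>THE\<close> yields an arbitrary value, which only
    enlarges \<open>F\<close> harmlessly.\<close>
  define F where "F = set rs \<union> (\<lambda>(j, k). THE i. i \<in> {1..m} \<and> L i j = k) ` set ps"
  have "card F \<le> card (set rs) + card (set ps)"
    unfolding F_def by (meson add_le_mono card_Un_le card_image_le finite_set le_refl le_trans)
  also have "\<dots> < m"
    using card_length[of rs] card_length[of ps] assms(2) by linarith
  finally have "card F < m" .
  moreover have "finite F" by (simp add: F_def)
  ultimately have "\<not> {1..m} \<subseteq> F"
    using card_mono[of F "{1..m}"] by auto
  then obtain i where i: "i \<in> {1..m}" "i \<notin> F" by blast
  have "L i j \<noteq> k" if "(j, k) \<in> set ps" for j k
  proof
    assume "L i j = k"
    moreover have "j \<in> {1..m}" using assms(1) that by blast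
    ultimately have "(THE i. i \<in> {1..m} \<and> L i j = k) = i"
      using i(1) col_inj by (intro the_equality) blast+
    then have "i \<in> F" using that by (force simp: F_def)
    then show False using i by simp
  qed
  moreover have "i \<notin> set rs" using i(2) by (simp add: F_def)
  ultimately show ?thesis using i(1) by blast
qed

lemma latin_transpose: "latin m (\<lambda>i j. L j i)"
  using latin by unfold_locales (auto simp: latin_square_def)

lemma ex_col_avoiding:
  assumes "\<forall>(i, k)\<in>set ps. i \<in> {1..m}" "length ps + length cs < m"
  shows "\<exists>j\<in>{1..m}. j \<notin> set cs \<and> (\<forall>(i, k)\<in>set ps. L i j \<noteq> k)"
  using latin.ex_row_avoiding[OF latin_transpose, of ps cs] assms by blast

lemma shattered_4:
  assumes m: "m > 10"
  shows "\<exists>S. shattered (latin_square_graph m L) S \<and> card S = 4"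
proof -
  note [[linarith_neq_limit = 0]]
  define r0 k0 k1 k2 :: nat where k: "r0 = 1" "k0 = 1" "k1 = 2" "k2 = 3"
  have in0: "r0 \<in> {1..m}" "k0 \<in> {1..m}" "k1 \<in> {1..m}" "k2 \<in> {1..m}"
    and k_ne: "k0 \<noteq> k1" "k0 \<noteq> k2" "k1 \<noteq> k2"
    using m by (auto simp: k)
  define A B where "A = L r0 k1" and "B = L r0 k2"
  \<comment> \<open>Besides making the symbol of \<open>c\<close> new, this keeps the crossings of
    \<open>r1\<close> with \<open>k1\<close> and \<open>k2\<close> from seeing the wrong one of
    \<open>a\<close>, \<open>b\<close> through their symbol.\<close>
  obtain r1 where r1: "r1 \<in> {1..m}" "r1 \<noteq> r0" "L r1 k0 \<noteq> A" "L r1 k0 \<noteq> B"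
    "L r1 k1 \<noteq> B" "L r1 k2 \<noteq> A"
    using ex_row_avoiding[of "[(k0, A), (k0, B), (k1, B), (k2, A)]" "[r0]"] m in0 by auto
  define C where "C = L r1 k0"
  \<comment> \<open>The same for \<open>r2\<close>; moreover, crossings in \<open>r2\<close> must
    not carry the symbol of \<open>c\<close>, nor those in \<open>r1\<close> the symbol of
    \<open>d\<close>. Eight pairs and two rows account for the bound 10.\<close>
  obtain r2 where r2: "r2 \<in> {1..m}" "r2 \<noteq> r0" "r2 \<noteq> r1" "L r2 k0 \<noteq> A" "L r2 k0 \<noteq> B"
    "L r2 k1 \<noteq> B" "L r2 k1 \<noteq> C" "L r2 k2 \<noteq> A" "L r2 k2 \<noteq> C"
    "L r2 k0 \<noteq> L r1 k1" "L r2 k0 \<noteq> L r1 k2"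
    using ex_row_avoiding[of "[(k0, A), (k0, B), (k1, B), (k1, C), (k2, A), (k2, C),
      (k0, L r1 k1), (k0, L r1 k2)]" "[r0, r1]"] m in0 by auto
  define D where "D = L r2 k0"
  define a b c d where abcd: "a = (r0, k1, A)" "b = (r0, k2, B)" "c = (r1, k0, C)" "d = (r2, k0, D)"
  have AB: "A \<noteq> B" using row_inj in0 k_ne unfolding A_def B_def by metis
  have CD: "C \<noteq> D" using col_inj in0 r1 r2 unfolding C_def D_def by metis
  have sym_in: "A \<in> {1..m}" "B \<in> {1..m}" "C \<in> {1..m}" "D \<in> {1..m}"
    unfolding A_def B_def C_def D_def using entry in0 r1 r2 by blast+
  have free_col: "\<exists>j\<in>{1..m}. j \<notin> {k0, k1, k2} \<and> L i j \<notin> {A, B, C, D}" if "i \<in> {1..m}" for i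
    using ex_col_avoiding[of "[(i, A), (i, B), (i, C), (i, D)]" "[k0, k1, k2]"] m that by auto
  have free_row: "\<exists>i\<in>{1..m}. i \<notin> {r0, r1, r2} \<and> L i j \<notin> {A, B, C, D}" if "j \<in> {1..m}" for j
    using ex_row_avoiding[of "[(j, A), (j, B), (j, C), (j, D)]" "[r0, r1, r2]"] m that by auto
  \<comment> \<open>The truth values encode the subset of {a, b, c, d} cut out by \<open>u\<close>;
    the families below produce all sixteen.\<close>
  define cut where "cut \<alpha> \<beta> \<gamma> \<delta> \<longleftrightarrow> (\<exists>u\<in>latin_vertices m L.
    latin_adj u a = \<alpha> \<and> latin_adj u b = \<beta> \<and> latin_adj u c = \<gamma> \<and> latin_adj u d = \<delta>)"
    for \<alpha> \<beta> \<gamma> \<delta>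
  have cutI: "cut \<alpha> \<beta> \<gamma> \<delta>" if "i \<in> {1..m}" "j \<in> {1..m}" "L i j = k"
    "latin_adj (i, j, k) a = \<alpha>" "latin_adj (i, j, k) b = \<beta>"
    "latin_adj (i, j, k) c = \<gamma>" "latin_adj (i, j, k) d = \<delta>" for i j k \<alpha> \<beta> \<gamma> \<delta>
    using that unfolding cut_def latin_vertices_def by blast
  note ne = r1(2-4)[folded C_def] r2(2-5)[folded D_def] k_ne AB CD
  note ne = ne ne[symmetric]
  note adj = abcd latin_adj_def
  have cut0: "cut False False False False"
  proof -
    obtain i where i: "i \<in> {1..m}" "i \<notin> {r0, r1, r2}" using free_row in0 by blast
    obtain j where j: "j \<in> {1..m}" "j \<notin> {k0, k1, k2}" "L i j \<notin> {A, B, C, D}"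
      using free_col[OF i(1)] by blast
    show ?thesis by (rule cutI[OF i(1) j(1) refl]) (use i j in \<open>auto simp: adj\<close>)
  qed
  \<comment> \<open>A free row and symbol leave only the column visible: {a}, {b} or {c, d}. Dually,
    \<open>cut_row\<close> gives {a, b}, {c} and {d}.\<close>
  have cut_col: "cut (j = k1) (j = k2) (j = k0) (j = k0)" if j: "j \<in> {k0, k1, k2}" for j
  proof -
    have "j \<in> {1..m}" using j in0 by auto
    then obtain i where i: "i \<in> {1..m}" "i \<notin> {r0, r1, r2}" "L i j \<notin> {A, B, C, D}"
      using free_row by blast
    show ?thesis by (rule cutI[OF i(1) \<open>j \<in> {1..m}\<close> refl]) (use i j in \<open>auto simp: adj\<close>)
  qed
  have cut_row: "cut (i = r0) (i = r0) (i = r1) (i = r2)" if i: "i \<in> {r0, r1, r2}" for i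
  proof -
    have "i \<in> {1..m}" using i in0 r1 r2 by auto
    then obtain j where j: "j \<in> {1..m}" "j \<notin> {k0, k1, k2}" "L i j \<notin> {A, B, C, D}"
      using free_col by blast
    show ?thesis by (rule cutI[OF \<open>i \<in> {1..m}\<close> j(1) refl]) (use i j in \<open>auto simp: adj\<close>)
  qed
  have cut_cross: "cut (j = k1) (j = k2) (i = r1) (i = r2)"
    if ij: "i \<in> {r1, r2}" "j \<in> {k1, k2}" for i j
  proof -
    have mem: "i \<in> {1..m}" "j \<in> {1..m}" using ij in0 r1 r2 by auto
    have "L r1 k1 \<noteq> A" "L r1 k2 \<noteq> B" "L r2 k1 \<noteq> A" "L r2 k2 \<noteq> B"
      using col_inj in0 r1 r2 unfolding A_def B_def by metis+
    moreover have "L r1 k1 \<noteq> C" "L r1 k2 \<noteq> C" "L r2 k1 \<noteq> D" "L r2 k2 \<noteq> D"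
      using row_inj in0 r1 r2 k_ne unfolding C_def D_def by metis+
    ultimately show ?thesis
      by (intro cutI[OF mem refl]) (use ij r1 r2 ne in \<open>auto simp: adj D_def\<close>)
  qed
  have cut_all: "cut True True True True"
    by (rule cutI[OF in0(1) in0(2) refl]) (use ne in \<open>auto simp: adj\<close>)
  have cut_sym_row: "cut True True (k = C) (k = D)" if k: "k \<in> {C, D}" for k
  proof -
    obtain j where j: "j \<in> {1..m}" "L r0 j = k" using row_ex in0 sym_in k by blast
    \<comment> \<open>In column \<open>k0\<close> the vertex would see both \<open>c\<close> and
      \<open>d\<close>; this is excluded because \<open>k\<close> already occurs there in another
      row.\<close>
    have "j \<noteq> k0" using j k in0 r1 r2 col_inj unfolding C_def D_def by blast
    then show ?thesis by (intro cutI[OF in0(1) j]) (use j k ne in \<open>auto simp: adj\<close>)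
  qed
  have cut_sym_col: "cut (k = A) (k = B) True True" if k: "k \<in> {A, B}" for k
  proof -
    obtain i where i: "i \<in> {1..m}" "L i k0 = k" using col_ex in0 sym_in k by blast
    have "i \<noteq> r0" using i k in0 k_ne row_inj unfolding A_def B_def by blast
    then show ?thesis by (intro cutI[OF i(1) in0(2) i(2)]) (use i k ne in \<open>auto simp: adj\<close>)
  qed
  have cut: "cut \<alpha> \<beta> \<gamma> \<delta>" for \<alpha> \<beta> \<gamma> \<delta>
    using cut0 cut_all cut_col[of k0] cut_col[of k1] cut_col[of k2]
      cut_row[of r0] cut_row[of r1] cut_row[of r2]
      cut_cross[of r1 k1] cut_cross[of r1 k2] cut_cross[of r2 k1] cut_cross[of r2 k2]
      cut_sym_row[of C] cut_sym_row[of D] cut_sym_col[of A] cut_sym_col[of B] ne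
    by (cases \<alpha>; cases \<beta>; cases \<gamma>; cases \<delta>) simp_all
  have "shattered (latin_square_graph m L) {a, b, c, d}"
    unfolding shattered_iff
  proof (intro conjI allI impI)
    show "{a, b, c, d} \<subseteq> latin_vertices m L"
      using in0 r1 r2 by (auto simp: abcd latin_vertices_def A_def B_def C_def D_def)
    fix X assume X: "X \<subseteq> {a, b, c, d}"
    obtain u where u: "u \<in> latin_vertices m L" "latin_adj u a = (a \<in> X)" "latin_adj u b = (b \<in> X)"
      "latin_adj u c = (c \<in> X)" "latin_adj u d = (d \<in> X)"
      using cut[of "a \<in> X" "b \<in> X" "c \<in> X" "d \<in> X"] unfolding cut_def by blast
    have "{v \<in> {a, b, c, d}. latin_adj u v} = X" using u X by blast
    then show "\<exists>u\<in>latin_vertices m L. {v \<in> {a, b, c, d}. latin_adj u v} = X"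
      using u(1) by blast
  qed
  moreover have "card {a, b, c, d} = 4"
    using ne by (simp add: abcd)
  ultimately show ?thesis by blast
qed

end

theorem theorem37:
  fixes m :: nat and L :: "nat \<Rightarrow> nat \<Rightarrow> nat"
  assumes "latin_square m L"
    and "card (pverts (latin_square_graph m L)) \<ge> 225"
  shows "vc_dim (latin_square_graph m L) = 4"
proof -
  interpret latin m L by unfold_locales fact
  have "15\<^sup>2 \<le> m\<^sup>2" using assms(2) by (simp add: card_latin_vertices)
  then have "15 \<le> m" using power2_nat_le_eq_le by blast
  then obtain S where "shattered (latin_square_graph m L) S" "card S = 4"
    using shattered_4 by auto
  moreover have "finite (pverts (latin_square_graph m L))"
    by (simp add: latin_square_graph_def finite_latin_vertices)
  ultimately show ?thesis
    unfolding vc_dim_def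
    by (intro Max_eqI finite_shattered_cards) (auto dest: card_shattered_le)
qed

end
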